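(* Let $N\in\mathbb{N}\setminus\{0,1\}$, $s\in(0,1)$ and $p\in[1,\infty)$. There exists a constant $C\in(0,\infty)$ depending only on $N$, $s$ and $p$ such that for all measurable functions $u\colon\mathbb{R}^N_+\to\mathbb{R}$ and $v\colon\partial\mathbb{R}^N_+\to\mathbb{R}$, $$\int_{\partial\mathbb{R}^N_+}\Bigl(\int_{\mathbb{R}^N_+}\frac{|v(x)-u(y)|^p}{|x-y|^{N+sp}}\,\mathrm{d}y\Bigr)\mathrm{d}x \le C\Bigl(\iint_{\partial\mathbb{R}^N_+\times\partial\mathbb{R}^N_+}\frac{|v(x)-v(y)|^p}{|x-y|^{N-1+sp}}\,\mathrm{d}x\,\mathrm{d}y+\int_{\mathbb{R}^N_+}\frac{|v(x')-u(x)|^p}{x_N^{sp+1}}\,\mathrm{d}x\Bigr).$$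
   Context: $\mathbb{R}^N_+ = \mathbb{R}^{N-1}\times(0,\infty)$, with points written $x=(x',x_N)$, $x'\in\mathbb{R}^{N-1}$, $x_N>0$. Its boundary $\partial\mathbb{R}^N_+ = \mathbb{R}^{N-1}\times\{0\}$ is identified with $\mathbb{R}^{N-1}$ (so that $v(x')$ means $v(x',0)$) and carries the $(N-1)$-dimensional Lebesgue measure; $|x-y|$ is the Euclidean distance in $\mathbb{R}^N$. Integrals of nonnegative functions take values in $[0,\infty]$. *)

theory Defs
  imports "HOL-Analysis.Analysis"
begin

text \<open>
  For \<open>CARD('n) = N - 1\<close> the type \<open>real ^ 'n\<close> is the space of dimension \<open>N - 1\<close>, and
  \<open>(real ^ 'n) \<times> real\<close>, whose product norm is Euclidean and whose measure \<open>lebesgue\<close> is the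
  \<open>N\<close>-dimensional Lebesgue measure, is the space of points \<open>(x', x\<^sub>N)\<close>. The boundary of the
  half-space is identified with \<open>real ^ 'n\<close> via \<open>x' \<mapsto> (x', 0)\<close>.
\<close>

definition half_space :: "((real ^ 'n) \<times> real) set" where
  "half_space = UNIV \<times> {0<..}"

end

theory Submission
  imports Defs
begin

text \<open>
  Write a point of the half-space as \<open>y = (z, t)\<close> and compare \<open>v x\<close> with \<open>u y\<close> through the boundary
  value \<open>v z\<close> at the foot of \<open>y\<close>:
  \<open>\<bar>v x - u y\<bar> powr p \<le> 2 powr p * (\<bar>v x - v z\<bar> powr p + \<bar>v z - u y\<bar> powr p)\<close>. In the first term only
  the kernel depends on the height \<open>t\<close>, and in the second only the kernel depends on \<open>x\<close>, so Tonelli's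
  theorem lets the kernel be integrated alone in each case. With \<open>b = N + s * p\<close>, integrating
  \<open>sqrt (\<bar>x - z\<bar>\<^sup>2 + t\<^sup>2) powr (-b)\<close> over \<open>t \<in> \<real>\<close> gives at most a multiple of
  \<open>\<bar>x - z\<bar> powr (1 - b)\<close>, which is the kernel of the boundary double integral; integrating it over
  \<open>x\<close> in the \<open>(N - 1)\<close>-dimensional boundary gives at most a multiple of \<open>t powr (N - 1 - b)\<close>,
  which is the weight \<open>1 / t powr (s * p + 1)\<close> of the other integral. The two bounds are the cases of
  dimension \<open>1\<close> and \<open>N - 1\<close> of a single estimate, \<open>nn_integral_kernel_le\<close>, and they give the
  inequality for Borel functions in \<open>nn_integral_trace_kernel_le\<close>.

  Tonelli's theorem requires \<open>u\<close> to be measurable for a product measure, and the Lebesgue measure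
  on the half-space is only the completion of one. Lebesgue measurable \<open>u\<close> and \<open>v\<close> are therefore
  first replaced by Borel functions that agree with them almost everywhere; none of the three
  integrals changes.
\<close>

section \<open>Integrals of the kernel\<close>

lemma nn_integral_powr_atLeast:
  fixes a b :: real
  assumes "0 < a" "0 < b"
  shows "(\<integral>\<^sup>+ \<rho>. ennreal (b * \<rho> powr (-b - 1)) * indicator {a..} \<rho> \<partial>lborel) = ennreal (a powr (-b))"
proof -
  have "(\<integral>\<^sup>+ \<rho>. ennreal (b * \<rho> powr (-b - 1)) * indicator {a..} \<rho> \<partial>lborel) = ennreal (0 - (- (a powr (-b))))"
  proof (rule nn_integral_FTC_atLeast)
    show "DERIV (\<lambda>x. - (x powr (-b))) x :> b * x powr (-b - 1)" if "a \<le> x" for x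
      using that assms by (auto intro!: derivative_eq_intros)
    show "((\<lambda>x. - (x powr (-b))) \<longlongrightarrow> 0) at_top"
      using tendsto_minus[OF tendsto_neg_powr[of "-b" "\<lambda>x. x" at_top]] assms by (simp add: filterlim_ident)
  qed (use assms in auto)
  then show ?thesis by simp
qed

text \<open>
  By the layer-cake formula the kernel \<open>m powr (-b)\<close> with \<open>m = sqrt ((norm x)\<^sup>2 + r\<^sup>2)\<close> is the integral
  of \<open>b * \<rho> powr (-b - 1)\<close> over \<open>\<rho> \<ge> m\<close>. Since \<open>m\<close> is at least \<open>r\<close> and at least \<open>norm x\<close>, exchanging
  the integrals leaves the volumes of the balls of radius \<open>\<rho> \<ge> r\<close>, that is, a power of \<open>\<rho>\<close> to
  integrate, and the integral converges exactly when \<open>b\<close> exceeds the dimension.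
\<close>
lemma nn_integral_kernel_le:
  fixes b :: real
  assumes b: "real DIM('a::euclidean_space) < b"
  shows "\<exists>C>0. \<forall>r>0. (\<integral>\<^sup>+ (x::'a). ennreal (1 / sqrt ((norm x)\<^sup>2 + r\<^sup>2) powr b) \<partial>lborel)
           \<le> ennreal (C * r powr (real DIM('a) - b))"
proof (intro exI conjI allI impI)
  define d where "d = real DIM('a)"
  define \<omega> where "\<omega> = unit_ball_vol d"
  have d: "0 < d" "d < b" and b0: "0 < b" and \<omega>: "0 < \<omega>"
    using b by (auto simp: d_def \<omega>_def intro!: unit_ball_vol_pos)
  show "0 < b * \<omega> / (b - d)" using d b0 \<omega> by simp
  fix r :: real assume r: "0 < r"
  define B where "B = {w :: 'a \<times> real. norm (fst w) \<le> snd w}"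
  have [measurable]: "B \<in> sets (borel \<Otimes>\<^sub>M borel)"
    unfolding B_def borel_prod by (intro borel_closed closed_Collect_le continuous_intros)
  have "(\<integral>\<^sup>+ (x::'a). ennreal (1 / sqrt ((norm x)\<^sup>2 + r\<^sup>2) powr b) \<partial>lborel)
    \<le> (\<integral>\<^sup>+ (x::'a). \<integral>\<^sup>+ \<rho>. ennreal (b * \<rho> powr (-b - 1)) * indicator {r..} \<rho> * indicator B (x, \<rho>) \<partial>lborel \<partial>lborel)"
  proof (rule nn_integral_mono)
    fix x :: 'a
    define m where "m = sqrt ((norm x)\<^sup>2 + r\<^sup>2)"
    have m: "r \<le> m" "norm x \<le> m"
      unfolding m_def by (auto intro: real_le_rsqrt)
    have "ennreal (1 / m powr b) = ennreal (m powr (-b))"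
      by (simp add: powr_minus_divide)
    also have "\<dots> = (\<integral>\<^sup>+ \<rho>. ennreal (b * \<rho> powr (-b - 1)) * indicator {m..} \<rho> \<partial>lborel)"
      using m r b0 by (intro nn_integral_powr_atLeast[symmetric]) auto
    also have "\<dots> \<le> (\<integral>\<^sup>+ \<rho>. ennreal (b * \<rho> powr (-b - 1)) * indicator {r..} \<rho> * indicator B (x, \<rho>) \<partial>lborel)"
      using m by (intro nn_integral_mono) (auto simp: indicator_def B_def)
    finally show "ennreal (1 / sqrt ((norm x)\<^sup>2 + r\<^sup>2) powr b) \<le> \<dots>"
      by (simp add: m_def)
  qed
  also have "\<dots> = (\<integral>\<^sup>+ \<rho>. \<integral>\<^sup>+ (x::'a). ennreal (b * \<rho> powr (-b - 1)) * indicator {r..} \<rho> * indicator B (x, \<rho>) \<partial>lborel \<partial>lborel)"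
    by (rule lborel_pair.Fubini'[symmetric]) measurable
  also have "\<dots> = (\<integral>\<^sup>+ \<rho>. ennreal (b * \<omega> / (b - d)) * (ennreal ((b - d) * \<rho> powr (-(b - d) - 1)) * indicator {r..} \<rho>) \<partial>lborel)"
  proof (rule nn_integral_cong)
    fix \<rho> :: real
    have "(\<integral>\<^sup>+ (x::'a). ennreal (b * \<rho> powr (-b - 1)) * indicator {r..} \<rho> * indicator B (x, \<rho>) \<partial>lborel)
        = (\<integral>\<^sup>+ (x::'a). ennreal (b * \<rho> powr (-b - 1)) * indicator {r..} \<rho> * indicator (cball 0 \<rho>) x \<partial>lborel)"
      by (intro nn_integral_cong) (auto simp: B_def indicator_def)
    also have "\<dots> = ennreal (b * \<rho> powr (-b - 1)) * indicator {r..} \<rho> * emeasure lborel (cball (0::'a) \<rho>)"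
      by (rule nn_integral_cmult_indicator) simp
    also have "\<dots> = ennreal (b * \<omega> / (b - d)) * (ennreal ((b - d) * \<rho> powr (-(b - d) - 1)) * indicator {r..} \<rho>)"
    proof (cases "r \<le> \<rho>")
      case True
      with r have \<rho>: "0 < \<rho>" by simp
      have "emeasure lborel (cball (0::'a) \<rho>) = ennreal (\<omega> * \<rho> powr d)"
        using \<rho> by (simp add: emeasure_cball \<omega>_def d_def powr_realpow)
      moreover have "b * \<rho> powr (-b - 1) * (\<omega> * \<rho> powr d)
          = b * \<omega> / (b - d) * ((b - d) * \<rho> powr (-(b - d) - 1))"
      proof -
        have "\<rho> powr (-(b - d) - 1) = \<rho> powr (-b - 1) * \<rho> powr d"
          by (simp add: powr_add[symmetric] algebra_simps)
        then show ?thesis using d by simp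
      qed
      ultimately show ?thesis
        using True d b0 \<omega> by (simp only: indicator_simps(1) atLeast_iff mult_1_right)
          (subst (1 2) ennreal_mult[symmetric], simp_all)
    qed auto
    finally show "(\<integral>\<^sup>+ (x::'a). ennreal (b * \<rho> powr (-b - 1)) * indicator {r..} \<rho> * indicator B (x, \<rho>) \<partial>lborel) = \<dots>" .
  qed
  also have "\<dots> = ennreal (b * \<omega> / (b - d)) * ennreal (r powr (-(b - d)))"
    using r d by (subst nn_integral_cmult, measurable, subst nn_integral_powr_atLeast) simp_all
  also have "\<dots> = ennreal (b * \<omega> / (b - d) * r powr (real DIM('a) - b))"
    using d b0 \<omega> by (simp add: ennreal_mult[symmetric] d_def)
  finally show "(\<integral>\<^sup>+ (x::'a). ennreal (1 / sqrt ((norm x)\<^sup>2 + r\<^sup>2) powr b) \<partial>lborel)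
    \<le> ennreal (b * \<omega> / (b - d) * r powr (real DIM('a) - b))" .
qed

lemma nn_integral_lborel_shift:
  fixes f :: "'a::euclidean_space \<Rightarrow> ennreal"
  assumes "f \<in> borel_measurable borel"
  shows "(\<integral>\<^sup>+ x. f (x - z) \<partial>lborel) = (\<integral>\<^sup>+ x. f x \<partial>lborel)"
proof -
  have "(\<integral>\<^sup>+ x. f x \<partial>lborel) = (\<integral>\<^sup>+ x. f x \<partial>distr lborel borel ((+) (- z)))"
    by (simp only: lborel_distr_plus)
  also have "\<dots> = (\<integral>\<^sup>+ x. f (x - z) \<partial>lborel)"
    using assms by (subst nn_integral_distr) auto
  finally show ?thesis by simp
qed

section \<open>The inequality for Borel functions\<close>

lemma powr_abs_diff_le:
  fixes a b c p :: real
  assumes "0 \<le> p"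
  shows "\<bar>a - c\<bar> powr p \<le> 2 powr p * (\<bar>a - b\<bar> powr p + \<bar>b - c\<bar> powr p)"
proof -
  define m where "m = max \<bar>a - b\<bar> \<bar>b - c\<bar>"
  have "\<bar>a - c\<bar> powr p \<le> (2 * m) powr p"
    using assms abs_triangle_ineq[of "a - b" "b - c"] by (intro powr_mono2) (auto simp: m_def max_def)
  also have "\<dots> = 2 powr p * m powr p"
    by (rule powr_mult)
  also have "m powr p \<le> \<bar>a - b\<bar> powr p + \<bar>b - c\<bar> powr p"
    by (auto simp: m_def max_def)
  finally show ?thesis by simp
qed

text \<open>
  The triangle inequality through \<open>v z\<close> splits the left-hand side into an integral \<open>V\<close> that only
  involves \<open>v\<close> and is integrated first along the vertical line above \<open>z\<close>, and an integral \<open>U\<close> that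
  compares \<open>u\<close> with \<open>v\<close> on the same vertical line and is integrated first along the boundary.
\<close>
lemma nn_integral_trace_kernel_le:
  fixes p \<sigma> :: real
  assumes p: "0 \<le> p" and \<sigma>: "0 < \<sigma>"
  shows "\<exists>C::real. 0 < C \<and> (\<forall>(u :: 'a::euclidean_space \<times> real \<Rightarrow> real) v.
    u \<in> borel_measurable borel \<longrightarrow> v \<in> borel_measurable borel \<longrightarrow>
    (\<integral>\<^sup>+ x. \<integral>\<^sup>+ y. ennreal (\<bar>v x - u y\<bar> powr p / norm ((x, 0) - y) powr (real DIM('a) + 1 + \<sigma>))
        * indicator (UNIV \<times> {0<..}) y \<partial>lborel \<partial>lborel)
    \<le> ennreal C *
      ((\<integral>\<^sup>+ x. \<integral>\<^sup>+ z. ennreal (\<bar>v x - v z\<bar> powr p / norm (x - z) powr (real DIM('a) + \<sigma>)) \<partial>lborel \<partial>lborel)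
       + (\<integral>\<^sup>+ y. ennreal (\<bar>v (fst y) - u y\<bar> powr p / snd y powr (\<sigma> + 1))
            * indicator (UNIV \<times> {0<..}) y \<partial>lborel)))"
proof -
  define d where "d = real DIM('a)"
  define b where "b = d + 1 + \<sigma>"
  define H where "H = (UNIV :: 'a set) \<times> {0::real <..}"
  have "real DIM(real) < b" "real DIM('a) < b"
    using \<sigma> by (auto simp: b_def d_def)
  from nn_integral_kernel_le[OF this(1)] nn_integral_kernel_le[OF this(2)]
  obtain C1 C2 where C1: "0 < C1"
      "\<And>r. r > 0 \<Longrightarrow> (\<integral>\<^sup>+ (t::real). ennreal (1 / sqrt ((norm t)\<^sup>2 + r\<^sup>2) powr b) \<partial>lborel)
        \<le> ennreal (C1 * r powr (1 - b))"
    and C2: "0 < C2"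
      "\<And>r. r > 0 \<Longrightarrow> (\<integral>\<^sup>+ (x::'a). ennreal (1 / sqrt ((norm x)\<^sup>2 + r\<^sup>2) powr b) \<partial>lborel)
        \<le> ennreal (C2 * r powr (d - b))"
    by (auto simp: d_def)
  have H[measurable]: "H \<in> sets borel"
    unfolding H_def by (intro borel_open open_Times) auto
  show ?thesis
  proof (intro exI[of _ "2 powr p * (C1 + C2)"] conjI allI impI)
    show "0 < 2 powr p * (C1 + C2)" using C1 C2 by simp
    fix u :: "'a \<times> real \<Rightarrow> real" and v :: "'a \<Rightarrow> real"
    assume [measurable]: "u \<in> borel_measurable borel" "v \<in> borel_measurable borel"
    define K where "K = (\<lambda>x y. norm ((x::'a, 0::real) - y) powr b)"
    have [measurable]: "fst \<in> borel_measurable (borel :: ('a \<times> real) measure)"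
        "snd \<in> borel_measurable (borel :: ('a \<times> real) measure)"
        "(\<lambda>w :: 'a \<times> ('a \<times> real). (fst w, 0) - snd w) \<in> borel_measurable (borel \<Otimes>\<^sub>M borel)"
      unfolding borel_prod by (intro borel_measurable_continuous_onI continuous_intros)+
    then have [measurable]: "(\<lambda>(x, y). K x y) \<in> borel_measurable (borel \<Otimes>\<^sub>M borel)"
      unfolding K_def split_beta by measurable
    define V where "V = (\<lambda>x y. ennreal (\<bar>v x - v (fst y)\<bar> powr p / K x y) * indicator H y)"
    define U where "U = (\<lambda>x y. ennreal (\<bar>v (fst y) - u y\<bar> powr p / K x y) * indicator H y)"
    have V[measurable]: "(\<lambda>(x, y). V x y) \<in> borel_measurable (lborel \<Otimes>\<^sub>M lborel)"
      unfolding V_def by measurable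
    have U[measurable]: "(\<lambda>(x, y). U x y) \<in> borel_measurable (lborel \<Otimes>\<^sub>M lborel)"
      unfolding U_def by measurable
    define A where "A = (\<integral>\<^sup>+ x. \<integral>\<^sup>+ z. ennreal (\<bar>v x - v z\<bar> powr p / norm (x - z) powr (d + \<sigma>)) \<partial>lborel \<partial>lborel)"
    define B where "B = (\<integral>\<^sup>+ y. ennreal (\<bar>v (fst y) - u y\<bar> powr p / snd y powr (\<sigma> + 1)) * indicator H y \<partial>lborel)"
    have K_eq: "K x (z, t) = sqrt ((norm (x - z))\<^sup>2 + t\<^sup>2) powr b" for x z t
      by (simp add: K_def norm_Pair)

    have V_le: "(\<integral>\<^sup>+ x. \<integral>\<^sup>+ y. V x y \<partial>lborel \<partial>lborel) \<le> ennreal C1 * A"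
    proof -
      have vertical: "(\<integral>\<^sup>+ t. V x (z, t) \<partial>lborel)
          \<le> ennreal C1 * ennreal (\<bar>v x - v z\<bar> powr p / norm (x - z) powr (d + \<sigma>))" for x z
        \<comment> \<open>For \<open>x = z\<close> the vertical integral of the kernel diverges at height \<open>0\<close>, but the factor
            \<open>\<bar>v x - v z\<bar> powr p\<close> in front of it vanishes, and on the right \<open>0 / 0 = 0\<close>.\<close>
      proof (cases "x = z")
        case True
        then show ?thesis by (simp add: V_def)
      next
        case False
        define r where "r = norm (x - z)"
        have r: "0 < r" using False by (simp add: r_def)
        \<comment> \<open>Enlarging the half-line \<open>t > 0\<close> to the real line gives the kernel estimate in dimension one.\<close>
        have "(\<integral>\<^sup>+ t. V x (z, t) \<partial>lborel)
          \<le> (\<integral>\<^sup>+ (t::real). ennreal (\<bar>v x - v z\<bar> powr p) * ennreal (1 / sqrt ((norm t)\<^sup>2 + r\<^sup>2) powr b) \<partial>lborel)"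
          by (intro nn_integral_mono)
             (auto simp: V_def K_eq r_def indicator_def ennreal_mult[symmetric] add.commute)
        also have "\<dots> = ennreal (\<bar>v x - v z\<bar> powr p) * (\<integral>\<^sup>+ (t::real). ennreal (1 / sqrt ((norm t)\<^sup>2 + r\<^sup>2) powr b) \<partial>lborel)"
          by (rule nn_integral_cmult) measurable
        also have "\<dots> \<le> ennreal (\<bar>v x - v z\<bar> powr p) * ennreal (C1 * r powr (1 - b))"
          by (intro mult_left_mono C1 r) simp
        also have "r powr (1 - b) = 1 / r powr (d + \<sigma>)"
          by (simp add: b_def powr_minus_divide[symmetric])
        finally show ?thesis
          using C1 by (simp add: ennreal_mult[symmetric] r_def mult.commute)
      qed
      have "(\<integral>\<^sup>+ y. V x y \<partial>lborel)
          \<le> (\<integral>\<^sup>+ z. ennreal C1 * ennreal (\<bar>v x - v z\<bar> powr p / norm (x - z) powr (d + \<sigma>)) \<partial>lborel)" for x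
      proof -
        have "(\<integral>\<^sup>+ y. V x y \<partial>lborel) = (\<integral>\<^sup>+ z. \<integral>\<^sup>+ t. V x (z, t) \<partial>lborel \<partial>lborel)"
          by (subst lborel_prod[symmetric], rule lborel.nn_integral_fst[symmetric], unfold lborel_prod) measurable
        then show ?thesis
          by (simp add: nn_integral_mono vertical)
      qed
      then have "(\<integral>\<^sup>+ x. \<integral>\<^sup>+ y. V x y \<partial>lborel \<partial>lborel)
          \<le> (\<integral>\<^sup>+ x. \<integral>\<^sup>+ z. ennreal C1 * ennreal (\<bar>v x - v z\<bar> powr p / norm (x - z) powr (d + \<sigma>)) \<partial>lborel \<partial>lborel)"
        by (intro nn_integral_mono)
      also have "\<dots> = ennreal C1 * A"
        unfolding A_def by (simp add: nn_integral_cmult)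
      finally show ?thesis .
    qed

    have U_le: "(\<integral>\<^sup>+ x. \<integral>\<^sup>+ y. U x y \<partial>lborel \<partial>lborel) \<le> ennreal C2 * B"
    proof -
      have horizontal: "(\<integral>\<^sup>+ x. U x y \<partial>lborel)
          \<le> ennreal C2 * (ennreal (\<bar>v (fst y) - u y\<bar> powr p / snd y powr (\<sigma> + 1)) * indicator H y)" for y
      proof (cases "y \<in> H")
        case False
        then show ?thesis by (simp add: U_def)
      next
        case True
        obtain z t where y: "y = (z, t)" by (cases y)
        have t: "0 < t" using True by (simp add: y H_def)
        have "(\<integral>\<^sup>+ x. U x y \<partial>lborel)
          = (\<integral>\<^sup>+ x. ennreal (\<bar>v z - u y\<bar> powr p) * ennreal (1 / sqrt ((norm (x - z))\<^sup>2 + t\<^sup>2) powr b) \<partial>lborel)"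
          using True by (intro nn_integral_cong) (auto simp: U_def y K_eq ennreal_mult[symmetric])
        also have "\<dots> = ennreal (\<bar>v z - u y\<bar> powr p) * (\<integral>\<^sup>+ x. ennreal (1 / sqrt ((norm (x - z))\<^sup>2 + t\<^sup>2) powr b) \<partial>lborel)"
          by (rule nn_integral_cmult) measurable
        also have "(\<integral>\<^sup>+ x. ennreal (1 / sqrt ((norm (x - z))\<^sup>2 + t\<^sup>2) powr b) \<partial>lborel)
            = (\<integral>\<^sup>+ (x::'a). ennreal (1 / sqrt ((norm x)\<^sup>2 + t\<^sup>2) powr b) \<partial>lborel)"
          by (rule nn_integral_lborel_shift) measurable
        also have "ennreal (\<bar>v z - u y\<bar> powr p) * \<dots> \<le> ennreal (\<bar>v z - u y\<bar> powr p) * ennreal (C2 * t powr (d - b))"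
          by (intro mult_left_mono C2 t) simp
        also have "t powr (d - b) = 1 / t powr (\<sigma> + 1)"
          by (simp add: b_def powr_minus_divide[symmetric] algebra_simps)
        finally show ?thesis
          using C2 True by (simp add: ennreal_mult[symmetric] y mult.commute)
      qed
      have "(\<integral>\<^sup>+ x. \<integral>\<^sup>+ y. U x y \<partial>lborel \<partial>lborel) = (\<integral>\<^sup>+ y. \<integral>\<^sup>+ x. U x y \<partial>lborel \<partial>lborel)"
        by (rule lborel_pair.Fubini'[symmetric]) (rule U)
      also have "\<dots> \<le> (\<integral>\<^sup>+ y. ennreal C2 *
          (ennreal (\<bar>v (fst y) - u y\<bar> powr p / snd y powr (\<sigma> + 1)) * indicator H y) \<partial>lborel)"
        by (intro nn_integral_mono horizontal)
      also have "\<dots> = ennreal C2 * B"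
        unfolding B_def by (rule nn_integral_cmult) measurable
      finally show ?thesis .
    qed

    have "(\<integral>\<^sup>+ x. \<integral>\<^sup>+ y. ennreal (\<bar>v x - u y\<bar> powr p / K x y) * indicator H y \<partial>lborel \<partial>lborel)
        \<le> (\<integral>\<^sup>+ x. \<integral>\<^sup>+ y. ennreal (2 powr p) * (V x y + U x y) \<partial>lborel \<partial>lborel)"
    proof (intro nn_integral_mono)
      fix x y
      have K0: "0 \<le> K x y" by (simp add: K_def)
      have "\<bar>v x - u y\<bar> powr p / K x y
          \<le> 2 powr p * (\<bar>v x - v (fst y)\<bar> powr p + \<bar>v (fst y) - u y\<bar> powr p) / K x y"
        by (intro divide_right_mono powr_abs_diff_le p K0)
      then have "ennreal (\<bar>v x - u y\<bar> powr p / K x y) \<le> ennreal (2 powr p *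
          (\<bar>v x - v (fst y)\<bar> powr p / K x y + \<bar>v (fst y) - u y\<bar> powr p / K x y))"
        by (intro ennreal_leI) (simp add: add_divide_distrib distrib_left)
      also have "\<dots> = ennreal (2 powr p) * (ennreal (\<bar>v x - v (fst y)\<bar> powr p / K x y)
          + ennreal (\<bar>v (fst y) - u y\<bar> powr p / K x y))"
        using K0 by (subst ennreal_mult) auto
      finally show "ennreal (\<bar>v x - u y\<bar> powr p / K x y) * indicator H y \<le> ennreal (2 powr p) * (V x y + U x y)"
        by (auto simp: V_def U_def indicator_def)
    qed
    also have "\<dots> = ennreal (2 powr p) *
        ((\<integral>\<^sup>+ x. \<integral>\<^sup>+ y. V x y \<partial>lborel \<partial>lborel) + (\<integral>\<^sup>+ x. \<integral>\<^sup>+ y. U x y \<partial>lborel \<partial>lborel))"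
      by (simp add: nn_integral_cmult nn_integral_add)
    also have "\<dots> \<le> ennreal (2 powr p) * (ennreal C1 * A + ennreal C2 * B)"
      by (intro mult_left_mono add_mono V_le U_le) simp
    also have "\<dots> \<le> ennreal (2 powr p) * (ennreal (C1 + C2) * A + ennreal (C1 + C2) * B)"
      using C1 C2 by (intro mult_left_mono add_mono mult_right_mono ennreal_leI) auto
    also have "\<dots> = ennreal (2 powr p * (C1 + C2)) * (A + B)"
      using C1 C2 by (subst ennreal_mult) (simp_all only: distrib_left mult.assoc powr_ge_zero add_nonneg_nonneg less_imp_le)
    finally show "(\<integral>\<^sup>+ x. \<integral>\<^sup>+ y. ennreal (\<bar>v x - u y\<bar> powr p / norm ((x, 0) - y) powr (real DIM('a) + 1 + \<sigma>))
        * indicator (UNIV \<times> {0<..}) y \<partial>lborel \<partial>lborel)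
      \<le> ennreal (2 powr p * (C1 + C2)) *
      ((\<integral>\<^sup>+ x. \<integral>\<^sup>+ z. ennreal (\<bar>v x - v z\<bar> powr p / norm (x - z) powr (real DIM('a) + \<sigma>)) \<partial>lborel \<partial>lborel)
       + (\<integral>\<^sup>+ y. ennreal (\<bar>v (fst y) - u y\<bar> powr p / snd y powr (\<sigma> + 1))
            * indicator (UNIV \<times> {0<..}) y \<partial>lborel))"
      by (simp only: K_def H_def A_def B_def b_def d_def)
  qed
qed

section \<open>Lebesgue measurable functions\<close>

lemma sigma_finite_completion:
  assumes "sigma_finite_measure M"
  shows "sigma_finite_measure (completion M)"
proof -
  obtain A where "countable A" "A \<subseteq> sets M" "\<Union>A = space M" "\<forall>a\<in>A. emeasure M a \<noteq> \<infinity>"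
    using sigma_finite_measure.sigma_finite_countable[OF assms] by blast
  then show ?thesis
    by (intro sigma_finite_measure.intro exI[of _ A]) (auto intro: sets_completionI_sets)
qed

lemma AE_lborel_fst:
  fixes P :: "'a::euclidean_space \<Rightarrow> bool"
  assumes "AE x in lborel. P x"
  shows "AE y in (lborel :: ('a \<times> 'b::euclidean_space) measure). P (fst y)"
proof -
  obtain S where S: "\<And>x. x \<in> space lborel - S \<Longrightarrow> P x" "S \<in> null_sets lborel"
    using AE_E3[OF assms] by blast
  show ?thesis
  proof (rule AE_I')
    show "S \<times> (UNIV :: 'b set) \<in> null_sets lborel"
      using S(2) by (subst lborel_prod[symmetric]) (auto intro: lborel.times_in_null_sets1)
    show "{y \<in> space lborel. \<not> P (fst y)} \<subseteq> S \<times> (UNIV :: 'b set)"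
      using S(1) by force
  qed
qed

theorem theorem7p1:
  fixes N :: nat and s p :: real
  assumes "N \<ge> 2" and "CARD('n::finite) = N - 1"
    and "0 < s" and "s < 1" and "1 \<le> p"
  shows "\<exists>C::real. 0 < C \<and>
    (\<forall>(u :: (real ^ 'n) \<times> real \<Rightarrow> real) (v :: real ^ 'n \<Rightarrow> real).
      u \<in> borel_measurable (lebesgue_on half_space) \<longrightarrow>
      v \<in> borel_measurable lebesgue \<longrightarrow>
      (\<integral>\<^sup>+ x. (\<integral>\<^sup>+ y. ennreal (\<bar>v x - u y\<bar> powr p / norm ((x, 0) - y) powr (real N + s * p))
                \<partial>lebesgue_on half_space) \<partial>lebesgue)
      \<le> ennreal C *
        ((\<integral>\<^sup>+ (x, y). ennreal (\<bar>v x - v y\<bar> powr p / norm (x - y) powr (real N - 1 + s * p))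
            \<partial>(lebesgue \<Otimes>\<^sub>M lebesgue))
         + (\<integral>\<^sup>+ x. ennreal (\<bar>v (fst x) - u x\<bar> powr p / snd x powr (s * p + 1))
            \<partial>lebesgue_on half_space)))"
proof -
  have dim: "real DIM(real ^ 'n) = real N - 1"
    using assms(1,2) by (simp add: of_nat_diff)
  have "0 \<le> p" "0 < s * p" using assms by auto
  from nn_integral_trace_kernel_le[OF this, where 'a = "real ^ 'n"]
  obtain C where C: "0 < C" and le: "\<And>(u :: (real ^ 'n) \<times> real \<Rightarrow> real) (v :: real ^ 'n \<Rightarrow> real).
    u \<in> borel_measurable borel \<Longrightarrow> v \<in> borel_measurable borel \<Longrightarrow>
    (\<integral>\<^sup>+ x. \<integral>\<^sup>+ y. ennreal (\<bar>v x - u y\<bar> powr p / norm ((x, 0) - y) powr (real N + s * p))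
        * indicator half_space y \<partial>lborel \<partial>lborel)
    \<le> ennreal C *
      ((\<integral>\<^sup>+ x. \<integral>\<^sup>+ z. ennreal (\<bar>v x - v z\<bar> powr p / norm (x - z) powr (real N - 1 + s * p)) \<partial>lborel \<partial>lborel)
       + (\<integral>\<^sup>+ y. ennreal (\<bar>v (fst y) - u y\<bar> powr p / snd y powr (s * p + 1))
            * indicator half_space y \<partial>lborel))"
    unfolding dim half_space_def[symmetric] by auto
  show ?thesis
  proof (intro exI[of _ C] conjI allI impI C)
    fix u :: "(real ^ 'n) \<times> real \<Rightarrow> real" and v :: "real ^ 'n \<Rightarrow> real"
    assume u: "u \<in> borel_measurable (lebesgue_on half_space)"
      and v: "v \<in> borel_measurable lebesgue"
    have "(half_space :: ((real ^ 'n) \<times> real) set) \<in> sets borel"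
      unfolding half_space_def by (intro borel_open open_Times) auto
    then have H: "(half_space :: ((real ^ 'n) \<times> real) set) \<in> sets lebesgue"
      by (simp add: sets_completionI_sets)
    have half_space_integral: "(\<integral>\<^sup>+ y. f y \<partial>lebesgue_on half_space) = (\<integral>\<^sup>+ y. f y * indicator half_space y \<partial>lborel)"
      for f :: "(real ^ 'n) \<times> real \<Rightarrow> ennreal"
      using H by (simp add: nn_integral_restrict_space nn_integral_completion)
    \<comment> \<open>Borel representatives are available for functions on the whole space, hence the extension by zero.\<close>
    have "(\<lambda>y. if y \<in> half_space then u y else 0) \<in> borel_measurable lebesgue"
      using u H by (simp add: borel_measurable_if)
    then obtain u' where u': "u' \<in> borel_measurable borel"
      and "AE y in lborel. (if y \<in> half_space then u y else 0) = u' y"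
      using completion_ex_borel_measurable_real[of _ lborel] by fastforce
    then have u_eq: "AE y in lborel. y \<in> half_space \<longrightarrow> u y = u' y"
      by (auto elim!: eventually_mono split: if_splits)
    obtain v' where v': "v' \<in> borel_measurable borel" and v_eq: "AE x in lborel. v x = v' x"
      using completion_ex_borel_measurable_real[OF v] by auto
    have "(\<integral>\<^sup>+ x. (\<integral>\<^sup>+ y. ennreal (\<bar>v x - u y\<bar> powr p / norm ((x, 0) - y) powr (real N + s * p))
                \<partial>lebesgue_on half_space) \<partial>lebesgue)
        = (\<integral>\<^sup>+ x. \<integral>\<^sup>+ y. ennreal (\<bar>v' x - u' y\<bar> powr p / norm ((x, 0) - y) powr (real N + s * p))
        * indicator half_space y \<partial>lborel \<partial>lborel)"
      unfolding half_space_integral nn_integral_completion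
    proof (rule nn_integral_cong_AE, use v_eq in eventually_elim, rule nn_integral_cong_AE, use u_eq in eventually_elim)
    qed (auto simp: indicator_def)
    also note le[OF u' v']
    also have "(\<integral>\<^sup>+ x. \<integral>\<^sup>+ z. ennreal (\<bar>v' x - v' z\<bar> powr p / norm (x - z) powr (real N - 1 + s * p)) \<partial>lborel \<partial>lborel)
      = (\<integral>\<^sup>+ x. \<integral>\<^sup>+ z. ennreal (\<bar>v x - v z\<bar> powr p / norm (x - z) powr (real N - 1 + s * p)) \<partial>lebesgue \<partial>lebesgue)"
      unfolding nn_integral_completion
    proof (rule nn_integral_cong_AE, use v_eq in eventually_elim, rule nn_integral_cong_AE, use v_eq in eventually_elim)
    qed auto
    \<comment> \<open>In the double integral over the boundary the measure is a genuine product of the two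
        \<open>\<sigma>\<close>-finite Lebesgue measures, and the integrand is measurable for it, so Tonelli applies.\<close>
    also have "\<dots> = (\<integral>\<^sup>+ (x, y). ennreal (\<bar>v x - v y\<bar> powr p / norm (x - y) powr (real N - 1 + s * p))
            \<partial>(lebesgue \<Otimes>\<^sub>M lebesgue))"
    proof -
      interpret lebesgue: sigma_finite_measure "lebesgue :: (real ^ 'n) measure"
        by (rule sigma_finite_completion[OF sigma_finite_lborel])
      have id: "(\<lambda>x. x) \<in> borel_measurable (lebesgue :: (real ^ 'n) measure)"
        by (rule measurable_completion) simp
      have [measurable]:
          "fst \<in> borel_measurable ((lebesgue :: (real ^ 'n) measure) \<Otimes>\<^sub>M (lebesgue :: (real ^ 'n) measure))"
          "snd \<in> borel_measurable ((lebesgue :: (real ^ 'n) measure) \<Otimes>\<^sub>M (lebesgue :: (real ^ 'n) measure))"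
        using measurable_compose[OF measurable_fst id] measurable_compose[OF measurable_snd id] by auto
      have [measurable]: "(\<lambda>w. v (fst w)) \<in> borel_measurable (lebesgue \<Otimes>\<^sub>M (lebesgue :: (real ^ 'n) measure))"
          "(\<lambda>w. v (snd w)) \<in> borel_measurable ((lebesgue :: (real ^ 'n) measure) \<Otimes>\<^sub>M lebesgue)"
        using measurable_compose[OF measurable_fst v] measurable_compose[OF measurable_snd v] by auto
      have "(\<lambda>w. ennreal (\<bar>v (fst w) - v (snd w)\<bar> powr p / norm (fst w - snd w) powr (real N - 1 + s * p)))
          \<in> borel_measurable (lebesgue \<Otimes>\<^sub>M lebesgue)"
        by measurable
      from lebesgue.nn_integral_fst[OF this] show ?thesis
        by (simp add: case_prod_unfold)
    qed
    also have "(\<integral>\<^sup>+ y. ennreal (\<bar>v' (fst y) - u' y\<bar> powr p / snd y powr (s * p + 1))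
            * indicator half_space y \<partial>lborel)
       = (\<integral>\<^sup>+ x. ennreal (\<bar>v (fst x) - u x\<bar> powr p / snd x powr (s * p + 1)) \<partial>lebesgue_on half_space)"
      unfolding half_space_integral
      by (rule nn_integral_cong_AE, use u_eq AE_lborel_fst[OF v_eq] in eventually_elim)
         (auto simp: indicator_def)
    finally show "(\<integral>\<^sup>+ x. (\<integral>\<^sup>+ y. ennreal (\<bar>v x - u y\<bar> powr p / norm ((x, 0) - y) powr (real N + s * p))
                \<partial>lebesgue_on half_space) \<partial>lebesgue)
      \<le> ennreal C *
        ((\<integral>\<^sup>+ (x, y). ennreal (\<bar>v x - v y\<bar> powr p / norm (x - y) powr (real N - 1 + s * p))
            \<partial>(lebesgue \<Otimes>\<^sub>M lebesgue))
         + (\<integral>\<^sup>+ x. ennreal (\<bar>v (fst x) - u x\<bar> powr p / snd x powr (s * p + 1))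
            \<partial>lebesgue_on half_space))" .
  qed
qed

end
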